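(* Let $L$ be an even lattice of signature $(b_+,b_-)$, let $\Lambda\subseteq L$ be a sub-lattice of finite index, let $v\in\operatorname{Gr}(L_{\mathbb{R}})=\operatorname{Gr}(\Lambda_{\mathbb{R}})$, let $\Gamma$ be a finite index subgroup of $\operatorname{Mp}_2(\mathbb{Z})$ with image $\tilde\Gamma$ under the involution $(A,\phi)\mapsto(\tilde A,\tilde\phi)$, and let $k,l\in\frac12\mathbb{Z}$. Let $F$ be a modular form of weight $\big(k-\frac{b_+}{2},l-\frac{b_-}{2}\big)$ and representation $\rho_L^*$ with respect to $\Gamma$, and let $G$ be a modular form of weight $\big(k-\frac{b_-}{2},l-\frac{b_+}{2}\big)$ and representation $\rho_L$ with respect to $\tilde\Gamma$. Then $$\Phi_{\Lambda,v}^{\uparrow^{L(-1)}_{\Lambda(-1)}F}=\Phi_{L,v}^{F}\qquad\text{and}\qquad\tilde\Phi_{\Lambda,v}^{\uparrow^{L}_{\Lambda}G}=\tilde\Phi_{L,v}^{G}.$$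
   Context: Lattices. An even lattice is a free $\mathbb{Z}$-module $L$ of finite rank with a non-degenerate symmetric bilinear form $(\cdot,\cdot):L\times L\to\mathbb{Z}$ such that $\lambda^2:=(\lambda,\lambda)$ is even for every $\lambda\in L$. Put $L_{\mathbb{R}}=L\otimes\mathbb{R}$, $L_{\mathbb{C}}=L\otimes\mathbb{C}$; the pairing and $\lambda\mapsto\lambda^2$ are extended bilinearly (no complex conjugation). The dual lattice is $L^*=\{\lambda\in L_{\mathbb{R}}:(\lambda,L)\subseteq\mathbb{Z}\}\supseteq L$, and $D_L=L^*/L$ is a finite group. $\mathbb{C}[D_L]$ has basis $\{\mathfrak{e}_\gamma\}_{\gamma\in D_L}$. Write $\mathbf{e}(w)=e^{2\pi iw}$ and $\mathcal{H}=\{\tau=x+iy\in\mathbb{C}:y>0\}$. $\operatorname{Gr}(L_{\mathbb{R}})$ is the set of orthogonal decompositions $v$: $L_{\mathbb{R}}=v_+\oplus v_-$ with $v_+$ positive definite and $v_-$ negative definite; $\lambda_{v_\pm}$ is the orthogonal projection of $\lambda$ onto $v_\pm$. The Jacobi--Siegel theta function: for $\tau\in\mathcal{H}$, $\zeta\in L_{\mathbb{C}}$, $$\Theta_L(\tau,\zeta;v)=\sum_{\gamma\in D_L}\Big[\sum_{\lambda\in L+\gamma}\mathbf{e}\Big(\tau\tfrac{\lambda_{v_+}^2}{2}+\overline{\tau}\tfrac{\lambda_{v_-}^2}{2}+(\lambda,\zeta)\Big)\Big]\mathfrak{e}_\gamma ,$$ and similarly for $\Lambda$. Metaplectic group. For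 $A=\begin{pmatrix}a&b\\c&d\end{pmatrix}\in\operatorname{SL}_2(\mathbb{R})$ put $A\tau=\frac{a\tau+b}{c\tau+d}$, $j(A,\tau)=c\tau+d$. $\operatorname{Mp}_2(\mathbb{R})$ is the group of pairs $(A,\phi)$ with $A\in\operatorname{SL}_2(\mathbb{R})$, $\phi:\mathcal{H}\to\mathbb{C}$ holomorphic, $\phi^2(\tau)=j(A,\tau)$, with product $(A,\phi)(B,\psi)=(AB,(\phi\circ B)\psi)$; $\operatorname{Mp}_2(\mathbb{Z})$ is the inverse image of $\operatorname{SL}_2(\mathbb{Z})$. It is generated by $T=\big(\begin{pmatrix}1&1\\0&1\end{pmatrix},1\big)$ and $S=\big(\begin{pmatrix}0&-1\\1&0\end{pmatrix},\sqrt{\tau}\big)$ with $\sqrt\tau\in\mathcal{H}$. The Weil representation $\rho_L$ of $\operatorname{Mp}_2(\mathbb{Z})$ on $\mathbb{C}[D_L]$ is given by $$\rho_L(T)\mathfrak{e}_\gamma=\mathbf{e}(\tfrac{\gamma^2}{2})\mathfrak{e}_\gamma,\qquad \rho_L(S)\mathfrak{e}_\gamma=\frac{\mathbf{e}\big(\frac{b_--b_+}{8}\big)}{\sqrt{|D_L|}}\sum_{\delta\in D_L}\mathbf{e}(-(\gamma,\delta))\mathfrak{e}_\delta .$$ $L(-1)$ is $L$ with the forms negated; $\mathbb{C}[D_{L(-1)}]$ has basis $\{\mathfrak{e}_\gamma^*\}_{\gamma\in D_L}$, regarded as dual to $\{\mathfrak{e}_\gamma\}$ via the bilinear pairing $\langle\cdot,\cdot\rangle_L:\mathbb{C}[D_L]\times\mathbb{C}[D_{L(-1)}]\to\mathbb{C}$,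 $\langle\mathfrak{e}_\gamma,\mathfrak{e}_\delta^*\rangle_L=\delta_{\gamma,\delta}$. $\rho_L^*=\rho_{L(-1)}$ is the dual representation: $\langle\rho_L(A,\phi)U,\rho_L^*(A,\phi)V\rangle_L=\langle U,V\rangle_L$. Involution. For $(A,\phi)\in\operatorname{Mp}_2(\mathbb{R})$ with $A=\begin{pmatrix}a&b\\c&d\end{pmatrix}$, put $\tilde A=\begin{pmatrix}a&-b\\-c&d\end{pmatrix}$ and $\tilde\phi(\tau)=\overline{\phi(-\overline\tau)}$. $\omega_L:\mathbb{C}[D_L]\to\mathbb{C}[D_{L(-1)}]$ is the $\mathbb{C}$-linear map with $\omega_L(\mathfrak{e}_\gamma)=\mathfrak{e}_\gamma^*$. Modular forms. For $p,q\in\frac12\mathbb{Z}$, a modular form of weight $(p,q)$ and representation $\rho$ (here a Weil representation or its dual, on the space $V_\rho$) with respect to a finite index subgroup $\Gamma$ is a smooth $F:\mathcal{H}\to V_\rho$ with $F(A\tau)=\phi(\tau)^{2p}\overline{\phi(\tau)}^{2q}\rho(A,\phi)F(\tau)$ for all $\tau\in\mathcal{H}$, $(A,\phi)\in\Gamma$, and with at most linear exponential growth at the cusps (for every $A\in\operatorname{SL}_2(\mathbb{Z})$ there is $C$ with $F(A\tau)=O(e^{Cy})$ as $y\to\infty$, uniformly for $x$ in bounded sets). Associated functions. For a modular form $F$ with representation $\rho_L^*$, $\Phi_{L,v}^F(\tau,\zeta)=\langle\Theta_L(\tau,\zeta;v),F(\tau)\rangle_L$ for $(\tau,\zeta)\in\mathcal{H}\times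 L_{\mathbb{C}}$. For a modular form $G$ with representation $\rho_L$, $\tilde G(\tau)=\omega_L(G(-\overline\tau))$ and $\tilde\Phi_{L,v}^G=\Phi_{L,v}^{\tilde G}$. The same notation is used with $\Lambda$ in place of $L$ (note $\Lambda_{\mathbb{C}}=L_{\mathbb{C}}$). Arrow operators. Let $H=L/\Lambda$, an isotropic subgroup of $D_\Lambda$, with $H^\perp=L^*/\Lambda\subseteq D_\Lambda$ and $D_L=H^\perp/H$. The map $\uparrow^L_\Lambda:\mathbb{C}[D_L]\to\mathbb{C}[D_\Lambda]$ is the linear map $\uparrow^L_\Lambda\mathfrak{e}_\gamma=\sum_{\delta\in H^\perp,\ \delta+H=\gamma}\mathfrak{e}_\delta$. The map $\uparrow^{L(-1)}_{\Lambda(-1)}:\mathbb{C}[D_{L(-1)}]\to\mathbb{C}[D_{\Lambda(-1)}]$ is given by the same formula with $\mathfrak{e}^*$ in place of $\mathfrak{e}$. These maps commute with the Weil representations, hence take modular forms to modular forms of the same weight (applied pointwise in $\tau$). *)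

theory Defs
  imports
    "HOL-Analysis.Analysis"
    "HOL-Algebra.Coset"
    "HOL-Library.Set_Algebras"
begin

section \<open>Even lattices\<close>

text \<open>
  A lattice \<open>L\<close> is a subset of the real vector space \<open>L \<otimes> \<real>\<close>, which is the whole type
  \<open>'v\<close>: it is the \<open>\<int>\<close>-span of a finite \<open>\<real>\<close>-basis.  The class \<open>real_vector\<close> (rather than
  \<open>euclidean_space\<close>) admits rank 0.  The form \<open>B\<close> is the \<open>\<real>\<close>-bilinear extension of the
  form of the lattice, so that \<open>B\<close> is shared by \<open>L\<close> and its sublattices of finite index.
\<close>

definition int_span :: "'v::real_vector set \<Rightarrow> 'v set" where
  "int_span E = {\<Sum>b\<in>E. of_int (c b) *\<^sub>R b | c :: 'v \<Rightarrow> int. True}"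

definition even_lattice :: "('v::real_vector \<Rightarrow> 'v \<Rightarrow> real) \<Rightarrow> 'v set \<Rightarrow> bool" where
  "even_lattice B L \<longleftrightarrow>
     (\<exists>E. finite E \<and> independent E \<and> span E = UNIV \<and> L = int_span E) \<and>
     bilinear B \<and> (\<forall>x y. B x y = B y x) \<and>
     (\<forall>x\<in>L. \<forall>y\<in>L. B x y \<in> \<int>) \<and>
     (\<forall>x\<in>L. \<exists>m::int. B x x = 2 * of_int m) \<and>
     (\<forall>x\<in>L. (\<forall>y\<in>L. B x y = 0) \<longrightarrow> x = 0)"

definition neg_form :: "('v \<Rightarrow> 'v \<Rightarrow> real) \<Rightarrow> 'v \<Rightarrow> 'v \<Rightarrow> real" where
  "neg_form B = (\<lambda>x y. - B x y)"

definition pos_def_on :: "('v::real_vector \<Rightarrow> 'v \<Rightarrow> real) \<Rightarrow> 'v set \<Rightarrow> bool" where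
  "pos_def_on B W \<longleftrightarrow> (\<forall>w\<in>W. w \<noteq> 0 \<longrightarrow> B w w > 0)"

definition sig_pos :: "('v::real_vector \<Rightarrow> 'v \<Rightarrow> real) \<Rightarrow> nat" where
  "sig_pos B = (GREATEST n. \<exists>W. subspace W \<and> pos_def_on B W \<and> dim W = n)"

definition signature :: "('v::real_vector \<Rightarrow> 'v \<Rightarrow> real) \<Rightarrow> nat \<times> nat" where
  "signature B = (sig_pos B, sig_pos (neg_form B))"

definition Gr :: "('v::real_vector \<Rightarrow> 'v \<Rightarrow> real) \<Rightarrow> ('v set \<times> 'v set) set" where
  "Gr B = {(P, N). subspace P \<and> subspace N \<and> P + N = UNIV \<and> P \<inter> N = {0} \<and>
                   (\<forall>x\<in>P. \<forall>y\<in>N. B x y = 0) \<and> pos_def_on B P \<and> pos_def_on (neg_form B) N}"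

definition orth_proj :: "('v::real_vector \<Rightarrow> 'v \<Rightarrow> real) \<Rightarrow> 'v set \<Rightarrow> 'v \<Rightarrow> 'v" where
  "orth_proj B W x = (THE p. p \<in> W \<and> (\<forall>w\<in>W. B (x - p) w = 0))"

definition finite_index_sublattice :: "'v::real_vector set \<Rightarrow> 'v set \<Rightarrow> bool" where
  "finite_index_sublattice M L \<longleftrightarrow>
     M \<subseteq> L \<and> 0 \<in> M \<and> (\<forall>x\<in>M. \<forall>y\<in>M. x - y \<in> M) \<and> finite ((\<lambda>x. x +o M) ` L)"


section \<open>Discriminant groups and their group algebras\<close>

definition dual_lattice :: "('v::real_vector \<Rightarrow> 'v \<Rightarrow> real) \<Rightarrow> 'v set \<Rightarrow> 'v set" where
  "dual_lattice B L = {x. \<forall>y\<in>L. B x y \<in> \<int>}"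

text \<open>Elements of a quotient \<open>A / L\<close> are the cosets \<open>x + L\<close> themselves, as subsets of \<open>'v\<close>.\<close>

definition quot :: "'v::real_vector set \<Rightarrow> 'v set \<Rightarrow> 'v set set" where
  "quot A L = (\<lambda>x. x +o L) ` A"

definition disc_group :: "('v::real_vector \<Rightarrow> 'v \<Rightarrow> real) \<Rightarrow> 'v set \<Rightarrow> 'v set set" where
  "disc_group B L = quot (dual_lattice B L) L"

lemma disc_group_neg_form: "disc_group (neg_form B) L = disc_group B L"
  by (simp add: disc_group_def dual_lattice_def neg_form_def)

text \<open>
  \<open>\<complex>[D]\<close>: complex functions supported on \<open>D\<close>.  Since \<open>L\<close> and \<open>L(-1)\<close> have the same dual lattice,
  \<open>disc_group (neg_form B) L = disc_group B L\<close>, and \<open>basis_elt \<gamma>\<close> also serves as the dual basis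
  element \<open>e\<^sup>*\<^sub>\<gamma>\<close> of \<open>\<complex>[D]\<close> for \<open>L(-1)\<close>.
\<close>

definition group_alg :: "'v set set \<Rightarrow> ('v set \<Rightarrow> complex) set" where
  "group_alg D = {U. \<forall>\<gamma>. \<gamma> \<notin> D \<longrightarrow> U \<gamma> = 0}"

definition basis_elt :: "'v set \<Rightarrow> 'v set \<Rightarrow> complex" where
  "basis_elt \<gamma> = (\<lambda>\<delta>. if \<delta> = \<gamma> then 1 else 0)"

definition pairing ::
  "('v::real_vector \<Rightarrow> 'v \<Rightarrow> real) \<Rightarrow> 'v set \<Rightarrow> ('v set \<Rightarrow> complex) \<Rightarrow> ('v set \<Rightarrow> complex) \<Rightarrow> complex" where
  "pairing B L U V = (\<Sum>\<gamma>\<in>disc_group B L. U \<gamma> * V \<gamma>)"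

definition omega ::
  "('v::real_vector \<Rightarrow> 'v \<Rightarrow> real) \<Rightarrow> 'v set \<Rightarrow> ('v set \<Rightarrow> complex) \<Rightarrow> ('v set \<Rightarrow> complex)" where
  "omega B L U = (\<lambda>\<delta>. \<Sum>\<gamma>\<in>disc_group B L. U \<gamma> * basis_elt \<gamma> \<delta>)"


section \<open>The metaplectic group\<close>

definition upper_half :: "complex set" where
  "upper_half = {\<tau>. Im \<tau> > 0}"

definition SL2_act :: "real^2^2 \<Rightarrow> complex \<Rightarrow> complex" where
  "SL2_act A \<tau> = (of_real (A$1$1) * \<tau> + of_real (A$1$2)) / (of_real (A$2$1) * \<tau> + of_real (A$2$2))"

definition autj :: "real^2^2 \<Rightarrow> complex \<Rightarrow> complex" where
  "autj A \<tau> = of_real (A$2$1) * \<tau> + of_real (A$2$2)"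

definition SL2R :: "(real^2^2) set" where
  "SL2R = {A. det A = 1}"

definition SL2Z :: "(real^2^2) set" where
  "SL2Z = {A \<in> SL2R. \<forall>i j. A$i$j \<in> \<int>}"

type_synonym mp2 = "(real^2^2) \<times> (complex \<Rightarrow> complex)"

text \<open>
  The functions \<open>\<phi>\<close> are defined on the upper half plane only, hence are taken to be
  extensional, so that equality of pairs is equality in the metaplectic group.
\<close>

definition Mp2R :: "mp2 monoid" where
  "Mp2R = \<lparr> carrier = {(A, \<phi>). A \<in> SL2R \<and> \<phi> \<in> extensional upper_half \<and>
                        \<phi> holomorphic_on upper_half \<and> (\<forall>\<tau>\<in>upper_half. (\<phi> \<tau>)\<^sup>2 = autj A \<tau>)},
           monoid.mult = (\<lambda>(A, \<phi>) (A', \<psi>).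
             (A ** A', restrict (\<lambda>\<tau>. \<phi> (SL2_act A' \<tau>) * \<psi> \<tau>) upper_half)),
           one = (mat 1, restrict (\<lambda>\<tau>. 1) upper_half) \<rparr>"

definition Mp2Z :: "mp2 monoid" where
  "Mp2Z = Mp2R \<lparr> carrier := {g \<in> carrier Mp2R. fst g \<in> SL2Z} \<rparr>"

definition mp_T :: mp2 where
  "mp_T = (vector [vector [1, 1], vector [0, 1]], restrict (\<lambda>\<tau>. 1) upper_half)"

text \<open>On the upper half plane, \<open>csqrt\<close> is the square root with values in the upper half plane.\<close>

definition mp_S :: mp2 where
  "mp_S = (vector [vector [0, -1], vector [1, 0]], restrict csqrt upper_half)"

definition mp_tilde :: "mp2 \<Rightarrow> mp2" where
  "mp_tilde = (\<lambda>(A, \<phi>).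
     (vector [vector [A$1$1, - (A$1$2)], vector [- (A$2$1), A$2$2]],
      restrict (\<lambda>\<tau>. cnj (\<phi> (- cnj \<tau>))) upper_half))"


section \<open>The Weil representation\<close>

definition ee :: "complex \<Rightarrow> complex" where
  "ee w = exp (2 * of_real pi * \<i> * w)"

text \<open>
  Coset representatives: \<open>B\<close> on representatives is well defined modulo \<open>\<int>\<close>, and half
  the norm of a representative too, which is all that matters inside \<open>ee\<close>.
\<close>

definition rep :: "'v set \<Rightarrow> 'v" where
  "rep \<gamma> = (SOME x. x \<in> \<gamma>)"

definition is_weil_rep ::
  "('v::real_vector \<Rightarrow> 'v \<Rightarrow> real) \<Rightarrow> 'v set \<Rightarrow> (mp2 \<Rightarrow> ('v set \<Rightarrow> complex) \<Rightarrow> ('v set \<Rightarrow> complex)) \<Rightarrow> bool" where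
  "is_weil_rep B L \<rho> \<longleftrightarrow>
     (let D = disc_group B L; V = group_alg D; (bp, bm) = signature B in
        (\<forall>g\<in>carrier Mp2Z. \<forall>U\<in>V. \<rho> g U \<in> V) \<and>
        (\<forall>g\<in>carrier Mp2Z. \<forall>U\<in>V. \<forall>W\<in>V. \<forall>c.
            \<rho> g (\<lambda>\<gamma>. U \<gamma> + c * W \<gamma>) = (\<lambda>\<gamma>. \<rho> g U \<gamma> + c * \<rho> g W \<gamma>)) \<and>
        (\<forall>U\<in>V. \<rho> \<one>\<^bsub>Mp2Z\<^esub> U = U) \<and>
        (\<forall>g\<in>carrier Mp2Z. \<forall>h\<in>carrier Mp2Z. \<forall>U\<in>V. \<rho> (g \<otimes>\<^bsub>Mp2Z\<^esub> h) U = \<rho> g (\<rho> h U)) \<and>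
        (\<forall>\<gamma>\<in>D. \<rho> mp_T (basis_elt \<gamma>) =
            (\<lambda>\<epsilon>. ee (of_real (B (rep \<gamma>) (rep \<gamma>) / 2)) * basis_elt \<gamma> \<epsilon>)) \<and>
        (\<forall>\<gamma>\<in>D. \<rho> mp_S (basis_elt \<gamma>) =
            (\<lambda>\<epsilon>. ee ((of_nat bm - of_nat bp) / 8) / of_real (sqrt (real (card D))) *
               (\<Sum>\<delta>\<in>D. ee (- of_real (B (rep \<gamma>) (rep \<delta>))) * basis_elt \<delta> \<epsilon>))))"

text \<open>
  As \<open>mp_T\<close> and \<open>mp_S\<close> generate \<open>Mp2Z\<close>, the conditions determine the operators on \<open>\<complex>[D]\<close>
  uniquely; the choice only affects values outside \<open>Mp2Z\<close> and outside \<open>\<complex>[D]\<close>.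
\<close>

definition weil_rep ::
  "('v::real_vector \<Rightarrow> 'v \<Rightarrow> real) \<Rightarrow> 'v set \<Rightarrow> mp2 \<Rightarrow> ('v set \<Rightarrow> complex) \<Rightarrow> ('v set \<Rightarrow> complex)" where
  "weil_rep B L = (SOME \<rho>. is_weil_rep B L \<rho>)"

definition weil_rep_dual ::
  "('v::real_vector \<Rightarrow> 'v \<Rightarrow> real) \<Rightarrow> 'v set \<Rightarrow> mp2 \<Rightarrow> ('v set \<Rightarrow> complex) \<Rightarrow> ('v set \<Rightarrow> complex)" where
  "weil_rep_dual B L = weil_rep (neg_form B) L"


section \<open>Modular forms\<close>

text \<open>\<open>Ck_on n f S\<close>: \<open>f\<close> is \<open>n\<close> times continuously differentiable on the open set \<open>S\<close>, in the real sense.\<close>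

primrec Ck_on :: "nat \<Rightarrow> (complex \<Rightarrow> complex) \<Rightarrow> complex set \<Rightarrow> bool" where
  "Ck_on 0 f S = continuous_on S f"
| "Ck_on (Suc n) f S =
     (\<exists>f'. (\<forall>z\<in>S. (f has_derivative f' z) (at z)) \<and> (\<forall>h. Ck_on n (\<lambda>z. f' z h) S))"

definition smooth_on :: "(complex \<Rightarrow> complex) \<Rightarrow> complex set \<Rightarrow> bool" where
  "smooth_on f S \<longleftrightarrow> (\<forall>n. Ck_on n f S)"

text \<open>
  \<open>modular_form D \<rho> (p, q) \<Gamma> F\<close>: \<open>F\<close> takes values in \<open>\<complex>[D]\<close> and has weight \<open>(p, q)\<close>.  As \<open>p\<close> and \<open>q\<close>
  are half-integers, the floors are the integers \<open>2p\<close> and \<open>2q\<close>.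
\<close>

definition modular_form ::
  "'v set set \<Rightarrow> (mp2 \<Rightarrow> ('v set \<Rightarrow> complex) \<Rightarrow> ('v set \<Rightarrow> complex)) \<Rightarrow> real \<times> real \<Rightarrow> mp2 set
     \<Rightarrow> (complex \<Rightarrow> 'v set \<Rightarrow> complex) \<Rightarrow> bool" where
  "modular_form D \<rho> w \<Gamma> F \<longleftrightarrow>
     (let (p, q) = w in
        2 * p \<in> \<int> \<and> 2 * q \<in> \<int> \<and>
        (\<forall>\<tau>\<in>upper_half. F \<tau> \<in> group_alg D) \<and>
        (\<forall>\<gamma>\<in>D. smooth_on (\<lambda>\<tau>. F \<tau> \<gamma>) upper_half) \<and>
        (\<forall>(A, \<phi>)\<in>\<Gamma>. \<forall>\<tau>\<in>upper_half. F (SL2_act A \<tau>) =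
            (\<lambda>\<gamma>. \<phi> \<tau> powi \<lfloor>2 * p\<rfloor> * cnj (\<phi> \<tau>) powi \<lfloor>2 * q\<rfloor> * \<rho> (A, \<phi>) (F \<tau>) \<gamma>)) \<and>
        (\<forall>A\<in>SL2Z. \<exists>C. \<forall>X. bounded X \<longrightarrow> (\<exists>M. \<forall>\<^sub>F y in at_top. \<forall>x\<in>X. \<forall>\<gamma>\<in>D.
            cmod (F (SL2_act A (Complex x y)) \<gamma>) \<le> M * exp (C * y))))"


section \<open>Theta functions and associated functions\<close>

text \<open>A vector \<open>\<xi> + i\<eta>\<close> of the complexification of \<open>'v\<close> is represented by the pair \<open>(\<xi>, \<eta>)\<close>.\<close>

definition pair_complex :: "('v \<Rightarrow> 'v \<Rightarrow> real) \<Rightarrow> 'v \<Rightarrow> 'v \<times> 'v \<Rightarrow> complex" where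
  "pair_complex B x \<zeta> = of_real (B x (fst \<zeta>)) + \<i> * of_real (B x (snd \<zeta>))"

definition Theta ::
  "('v::real_vector \<Rightarrow> 'v \<Rightarrow> real) \<Rightarrow> 'v set \<Rightarrow> 'v set \<times> 'v set \<Rightarrow> complex \<Rightarrow> 'v \<times> 'v \<Rightarrow> 'v set \<Rightarrow> complex" where
  "Theta B L v \<tau> \<zeta> = (\<lambda>\<epsilon>. \<Sum>\<gamma>\<in>disc_group B L.
     (\<Sum>\<^sub>\<infinity>x\<in>\<gamma>. let xp = orth_proj B (fst v) x; xm = orth_proj B (snd v) x in
        ee (\<tau> * of_real (B xp xp / 2) + cnj \<tau> * of_real (B xm xm / 2) + pair_complex B x \<zeta>))
     * basis_elt \<gamma> \<epsilon>)"

definition Phi ::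
  "('v::real_vector \<Rightarrow> 'v \<Rightarrow> real) \<Rightarrow> 'v set \<Rightarrow> 'v set \<times> 'v set \<Rightarrow> (complex \<Rightarrow> 'v set \<Rightarrow> complex)
     \<Rightarrow> complex \<Rightarrow> 'v \<times> 'v \<Rightarrow> complex" where
  "Phi B L v F \<tau> \<zeta> = pairing B L (Theta B L v \<tau> \<zeta>) (F \<tau>)"

definition tilde_form ::
  "('v::real_vector \<Rightarrow> 'v \<Rightarrow> real) \<Rightarrow> 'v set \<Rightarrow> (complex \<Rightarrow> 'v set \<Rightarrow> complex)
     \<Rightarrow> complex \<Rightarrow> 'v set \<Rightarrow> complex" where
  "tilde_form B L G \<tau> = omega B L (G (- cnj \<tau>))"

definition Phi_tilde ::
  "('v::real_vector \<Rightarrow> 'v \<Rightarrow> real) \<Rightarrow> 'v set \<Rightarrow> 'v set \<times> 'v set \<Rightarrow> (complex \<Rightarrow> 'v set \<Rightarrow> complex)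
     \<Rightarrow> complex \<Rightarrow> 'v \<times> 'v \<Rightarrow> complex" where
  "Phi_tilde B L v G = Phi B L v (tilde_form B L G)"


section \<open>The arrow operators\<close>

text \<open>The orthogonal complement of \<open>H\<close> in the discriminant group of \<open>M\<close>, for the \<open>\<rat>/\<int>\<close>-valued pairing.\<close>

definition disc_perp ::
  "('v::real_vector \<Rightarrow> 'v \<Rightarrow> real) \<Rightarrow> 'v set \<Rightarrow> 'v set set \<Rightarrow> 'v set set" where
  "disc_perp B M H = {\<delta> \<in> disc_group B M. \<forall>\<eta>\<in>H. \<forall>x\<in>\<delta>. \<forall>y\<in>\<eta>. B x y \<in> \<int>}"

lemma coset_self: "0 \<in> M \<Longrightarrow> x \<in> x +o (M::'v::real_vector set)"
  by (force simp: elt_set_plus_def)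

lemma disc_perp_quot:
  fixes B :: "'v::real_vector \<Rightarrow> 'v \<Rightarrow> real"
  assumes L: "even_lattice B L" and M: "finite_index_sublattice M L"
  shows "disc_perp B M (quot L M) = quot (dual_lattice B L) M"
proof -
  have bil: "bilinear B" and int: "\<And>x y. x \<in> L \<Longrightarrow> y \<in> L \<Longrightarrow> B x y \<in> \<int>"
    using L by (auto simp: even_lattice_def)
  have MsL: "M \<subseteq> L" and zM: "0 \<in> M" using M by (auto simp: finite_index_sublattice_def)
  from L obtain E where LE: "L = int_span E" by (auto simp: even_lattice_def)
  have add: "x + y \<in> L" if xy: "x \<in> L" "y \<in> L" for x y
  proof -
    from xy obtain c d where "x = (\<Sum>b\<in>E. of_int (c b) *\<^sub>R b)" "y = (\<Sum>b\<in>E. of_int (d b) *\<^sub>R b)"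
      unfolding LE int_span_def by blast
    then have "x + y = (\<Sum>b\<in>E. of_int ((\<lambda>b. c b + d b) b) *\<^sub>R b)"
      by (simp add: sum.distrib scaleR_add_left)
    then show ?thesis unfolding LE int_span_def by (intro CollectI exI[of _ "\<lambda>b. c b + d b"]) simp
  qed
  show ?thesis
  proof (intro equalityI subsetI)
    fix \<delta> assume "\<delta> \<in> disc_perp B M (quot L M)"
    then obtain x where x: "\<delta> = x +o M" and
       p: "\<And>y. y \<in> L \<Longrightarrow> \<forall>a\<in>\<delta>. \<forall>b\<in>y +o M. B a b \<in> \<int>"
      by (auto simp: disc_perp_def disc_group_def quot_def)
    have "x \<in> dual_lattice B L"
      using p coset_self[OF zM] by (auto simp: dual_lattice_def x)
    then show "\<delta> \<in> quot (dual_lattice B L) M" by (auto simp: quot_def x)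
  next
    fix \<delta> assume "\<delta> \<in> quot (dual_lattice B L) M"
    then obtain x where x: "\<delta> = x +o M" "x \<in> dual_lattice B L" by (auto simp: quot_def)
    have "x \<in> dual_lattice B M" using x MsL by (auto simp: dual_lattice_def)
    moreover have "B (x + m) (y + n) \<in> \<int>" if "m \<in> M" "n \<in> M" "y \<in> L" for m n y
    proof -
      have "y + n \<in> L" using that MsL add by blast
      then have "B x (y + n) \<in> \<int>" "B m (y + n) \<in> \<int>"
        using x(2) int that MsL by (auto simp: dual_lattice_def)
      then show ?thesis by (simp add: bilinear_ladd[OF bil])
    qed
    ultimately show "\<delta> \<in> disc_perp B M (quot L M)"
      by (auto simp: disc_perp_def disc_group_def quot_def x(1) elt_set_plus_def)
  qed
qed

lemma Union_coset_quot:
  fixes L :: "'v::real_vector set"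
  assumes "0 \<in> M" "\<And>x y. x \<in> L \<Longrightarrow> y \<in> L \<Longrightarrow> x + y \<in> L" "M \<subseteq> L"
    "\<And>x y. x \<in> M \<Longrightarrow> y \<in> M \<Longrightarrow> x - y \<in> M"
  shows "\<Union>((x +o M) +o quot L M) = x +o L"
proof (intro equalityI subsetI)
  fix z assume "z \<in> \<Union>((x +o M) +o quot L M)"
  then obtain y m n where "y \<in> L" "m \<in> M" "n \<in> M" "z = (x + m) + (y + n)"
    by (auto simp: elt_set_plus_def quot_def set_plus_def)
  then show "z \<in> x +o L" using assms
    by (auto simp: elt_set_plus_def intro!: bexI[of _ "m + (y + n)"]) (metis subsetD)
next
  fix z assume "z \<in> x +o L"
  then obtain y where y: "y \<in> L" "z = x + y" by (auto simp: elt_set_plus_def)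
  have "z \<in> (x +o M) + (y +o M)" using y coset_self[OF assms(1)] by (auto simp: set_plus_def)
  moreover have "(x +o M) + (y +o M) \<in> (x +o M) +o quot L M"
    using y by (auto simp: elt_set_plus_def[of "x +o M"] quot_def)
  ultimately show "z \<in> \<Union>((x +o M) +o quot L M)" by blast
qed

text \<open>
  The coset \<open>\<delta> + H\<close> is a set of cosets of \<open>M\<close>; its union is the coset of \<open>L\<close> that
  corresponds to it under the isomorphism of \<open>H\<^sup>\<bottom>/H\<close> with the discriminant group of \<open>L\<close>.
\<close>

definition up_arrow ::
  "('v::real_vector \<Rightarrow> 'v \<Rightarrow> real) \<Rightarrow> 'v set \<Rightarrow> 'v set \<Rightarrow> ('v set \<Rightarrow> complex) \<Rightarrow> ('v set \<Rightarrow> complex)" where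
  "up_arrow B L M U = (let H = quot L M in
     (\<lambda>\<epsilon>. \<Sum>\<gamma>\<in>disc_group B L. U \<gamma> *
        (\<Sum>\<delta> | \<delta> \<in> disc_perp B M H \<and> \<Union>(\<delta> +o H) = \<gamma>. basis_elt \<delta> \<epsilon>)))"

end

theory Submission imports Defs begin

text \<open>
  Each coset of \<open>L\<close> in its dual is a finite disjoint union of cosets of \<open>\<Lambda>\<close>, and the arrow
  operator copies the component at \<open>\<gamma>\<close> to exactly the cosets of \<open>\<Lambda>\<close> contained in \<open>\<gamma>\<close>, so both
  identities amount to splitting the theta sum over \<open>\<gamma>\<close> into these pieces.  As
  divergent sums and sums over infinite sets have the junk value \<open>0\<close>, the
  splitting needs the convergence of the theta series, which follows by comparison with a product
  of one-dimensional Gaussian sums, and the finiteness of the discriminant groups.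
\<close>

section \<open>Positive definite forms in coordinates\<close>

text \<open>Gram-Schmidt: the part \<open>u\<close> of the new vector orthogonal to
  \<open>span E\<close> is split off, and the projection onto \<open>span E\<close> is corrected
  along \<open>u\<close>.\<close>

lemma posdef_orth_proj_exists:
  fixes R :: "'v::real_vector \<Rightarrow> 'v \<Rightarrow> real"
  assumes R: "bilinear R" and pos: "\<And>x. x \<noteq> 0 \<Longrightarrow> R x x > 0" and "finite E"
  shows "\<exists>p\<in>span E. \<forall>w\<in>span E. R (x - p) w = 0"
  using \<open>finite E\<close>
proof (induction E arbitrary: x rule: finite_induct)
  case empty
  show ?case using bilinear_rzero[OF R] by (intro bexI[of _ 0]) auto
next
  case (insert e E)
  obtain p where p: "p \<in> span E" "\<And>w. w \<in> span E \<Longrightarrow> R (e - p) w = 0"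
    using insert.IH by blast
  obtain q where q: "q \<in> span E" "\<And>w. w \<in> span E \<Longrightarrow> R (x - q) w = 0"
    using insert.IH by blast
  define u where "u = e - p"
  define c where "c = R (x - q) u / R u u"
  have sub: "span E \<subseteq> span (insert e E)" by (rule span_mono) auto
  have u: "u \<in> span (insert e E)"
    unfolding u_def using p(1) sub by (meson insertI1 span_base span_diff subsetD)
  \<comment> \<open>\<open>u\<close> vanishes if \<open>e\<close> already lies in
    \<open>span E\<close>; then \<open>c\<close> is 0 / 0 = 0 and both sides are 0.\<close>
  have cu: "R (x - q) u = c * R u u"
    using pos[of u] bilinear_rzero[OF R] by (cases "u = 0") (auto simp: c_def)
  show ?case
  proof (intro bexI[of _ "q + c *\<^sub>R u"] ballI)
    show "q + c *\<^sub>R u \<in> span (insert e E)"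
      using q(1) sub u by (intro span_add span_scale) auto
    fix w assume "w \<in> span (insert e E)"
    then obtain k where k: "w - k *\<^sub>R e \<in> span E" by (auto simp: span_breakdown_eq)
    define s where "s = (w - k *\<^sub>R e) + k *\<^sub>R p"
    have s: "s \<in> span E" unfolding s_def using k p(1) by (intro span_add span_scale)
    have w: "w = k *\<^sub>R u + s" by (simp add: s_def u_def algebra_simps)
    have eq: "x - (q + c *\<^sub>R u) = (x - q) - c *\<^sub>R u" by simp
    show "R (x - (q + c *\<^sub>R u)) w = 0"
      unfolding eq w using q(2)[OF s] p(2)[OF s, folded u_def] cu
      by (simp add: bilinear_lsub[OF R] bilinear_radd[OF R] bilinear_lmul[OF R] bilinear_rmul[OF R]
          del: diff_add_eq_diff_diff_swap)
  qed
qed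

text \<open>With \<open>q\<close> the component of \<open>e\<close> orthogonal to the other basis
  vectors, \<open>R x x\<close> is the sum of \<open>(a e)\<^sup>2 * R q q\<close> and a
  non-negative term, so \<open>1 / R q q\<close> serves as constant.\<close>

lemma posdef_coordinate_bound:
  fixes R :: "'v::real_vector \<Rightarrow> 'v \<Rightarrow> real"
  assumes R: "bilinear R" and sym: "\<And>x y. R x y = R y x"
    and pos: "\<And>x. x \<noteq> 0 \<Longrightarrow> R x x > 0"
    and E: "finite E" "independent E" and e: "e \<in> E"
  shows "\<exists>C\<ge>0. \<forall>a. (a e)\<^sup>2 \<le> C * R (\<Sum>b\<in>E. a b *\<^sub>R b) (\<Sum>b\<in>E. a b *\<^sub>R b)"
proof -
  obtain p where p: "p \<in> span (E - {e})" "\<And>w. w \<in> span (E - {e}) \<Longrightarrow> R (e - p) w = 0"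
    using posdef_orth_proj_exists[OF R pos, of "E - {e}" e] E by blast
  define q where "q = e - p"
  have "e \<notin> span (E - {e})" using E(2) e by (auto simp: dependent_def)
  then have "q \<noteq> 0" using p(1) by (auto simp: q_def)
  then have qq: "R q q > 0" by (rule pos)
  have nonneg: "R x x \<ge> 0" for x
    using pos[of x] bilinear_rzero[OF R] by (cases "x = 0") auto
  have "(a e)\<^sup>2 \<le> 1 / R q q * R (\<Sum>b\<in>E. a b *\<^sub>R b) (\<Sum>b\<in>E. a b *\<^sub>R b)" for a
  proof -
    \<comment> \<open>Writing \<open>e\<close> as \<open>q + p\<close> moves the multiple of
      \<open>p\<close> into the span of the other vectors, so that \<open>q\<close> carries exactly
      the coordinate \<open>a e\<close>.\<close>
    define s where "s = (\<Sum>b\<in>E - {e}. a b *\<^sub>R b) + a e *\<^sub>R p"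
    define x where "x = (\<Sum>b\<in>E. a b *\<^sub>R b)"
    have s: "s \<in> span (E - {e})"
      unfolding s_def using p(1)
      by (intro span_add span_sum span_scale[OF span_base] span_scale[OF p(1)]) auto
    have x: "x = a e *\<^sub>R q + s"
      unfolding x_def s_def q_def using E(1) e
      by (subst sum.remove[of E e]) (auto simp: algebra_simps)
    have "R q s = 0" using p(2)[OF s] by (simp add: q_def)
    then have "R x x = (a e)\<^sup>2 * R q q + R s s"
      unfolding x using sym[of s q]
      by (simp add: bilinear_ladd[OF R] bilinear_radd[OF R] bilinear_lmul[OF R]
          bilinear_rmul[OF R] power2_eq_square)
    then have "(a e)\<^sup>2 * R q q \<le> R x x" using nonneg[of s] by simp
    then show ?thesis using qq by (simp add: x_def field_simps)
  qed
  then show ?thesis using qq by (intro exI[of _ "1 / R q q"]) auto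
qed

text \<open>Summing the coordinate bounds over the basis replaces a compactness argument on a unit
  sphere. The sum of squares lets a Gaussian be compared with a product over coordinates.\<close>

lemma posdef_ge_sum_squares:
  fixes R :: "'v::real_vector \<Rightarrow> 'v \<Rightarrow> real"
  assumes R: "bilinear R" and sym: "\<And>x y. R x y = R y x"
    and pos: "\<And>x. x \<noteq> 0 \<Longrightarrow> R x x > 0"
    and E: "finite E" "independent E"
  obtains c where "c > 0"
    "\<And>a. c * (\<Sum>e\<in>E. (a e)\<^sup>2) \<le> R (\<Sum>e\<in>E. a e *\<^sub>R e) (\<Sum>e\<in>E. a e *\<^sub>R e)"
proof -
  obtain C where C: "\<And>e. e \<in> E \<Longrightarrow> C e \<ge> 0"
    "\<And>e a. e \<in> E \<Longrightarrow> (a e)\<^sup>2 \<le> C e * R (\<Sum>b\<in>E. a b *\<^sub>R b) (\<Sum>b\<in>E. a b *\<^sub>R b)"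
    using posdef_coordinate_bound[OF R sym pos E] by metis
  have nonneg: "R x x \<ge> 0" for x
    using pos[of x] bilinear_rzero[OF R] by (cases "x = 0") auto
  \<comment> \<open>The \<open>+ 1\<close> keeps \<open>K\<close> positive when the sum is 0, as in
    rank 0.\<close>
  define K where "K = sum C E + 1"
  have K: "K > 0" unfolding K_def using C(1) by (simp add: sum_nonneg add_nonneg_pos)
  have "1 / K * (\<Sum>e\<in>E. (a e)\<^sup>2) \<le> R (\<Sum>e\<in>E. a e *\<^sub>R e) (\<Sum>e\<in>E. a e *\<^sub>R e)" (is "_ \<le> ?r")
    for a
  proof -
    have "(\<Sum>e\<in>E. (a e)\<^sup>2) \<le> (\<Sum>e\<in>E. C e * ?r)" by (intro sum_mono C(2))
    also have "\<dots> = sum C E * ?r" by (simp add: sum_distrib_right)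
    also have "\<dots> \<le> K * ?r" unfolding K_def using nonneg by (intro mult_right_mono) auto
    finally show ?thesis using K by (simp add: field_simps)
  qed
  with K show thesis by (intro that[of "1 / K"]) auto
qed


section \<open>Gaussian sums over lattices\<close>

lemma summable_on_exp_neg_abs_int: "(\<lambda>n::int. exp (- \<bar>real_of_int n\<bar>)) summable_on UNIV"
proof -
  have geo: "(\<lambda>n::nat. exp (- real n)) summable_on UNIV"
  proof (rule norm_summable_imp_summable_on)
    have "(\<lambda>n. exp (- real n)) = (\<lambda>n. exp (-1) ^ n)"
      by (auto simp: exp_of_nat_mult[symmetric])
    then show "summable (\<lambda>n. norm (exp (- real n)))"
      by (simp add: summable_geometric)
  qed
  have "(\<lambda>n::int. exp (- \<bar>real_of_int n\<bar>)) summable_on range int"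
    using geo by (subst summable_on_reindex) (auto simp: o_def)
  moreover have "(\<lambda>n::int. exp (- \<bar>real_of_int n\<bar>)) summable_on range (\<lambda>n. - int n)"
    using geo by (subst summable_on_reindex) (auto simp: o_def inj_on_def)
  ultimately have "(\<lambda>n::int. exp (- \<bar>real_of_int n\<bar>)) summable_on (range int \<union> range (\<lambda>n. - int n))"
    by (rule summable_on_union)
  moreover have "n \<in> range int \<union> range (\<lambda>n. - int n)" for n
    by (cases n rule: int_cases2) auto
  then have "range int \<union> range (\<lambda>n. - int n) = UNIV" by blast
  ultimately show ?thesis by simp
qed

text \<open>The quadratic term absorbs both the linear term and an extra |n + t|, which leaves a
  two-sided geometric series as majorant.\<close>

lemma summable_on_gaussian_int:
  fixes a b t :: real
  assumes a: "a > 0"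
  shows "(\<lambda>n::int. exp (b * (real_of_int n + t) - a * (real_of_int n + t)\<^sup>2)) summable_on UNIV"
proof (rule summable_on_comparison_test)
  \<comment> \<open>The first summand is the maximum of (|b| + 1) r - a r^2 over real r; the second
    pays for replacing |n + t| by |n|.\<close>
  define K where "K = (\<bar>b\<bar> + 1)\<^sup>2 / (4 * a) + \<bar>t\<bar>"
  show "(\<lambda>n::int. exp K * exp (- \<bar>real_of_int n\<bar>)) summable_on UNIV"
    by (intro summable_on_cmult_right summable_on_exp_neg_abs_int)
  fix n :: int
  define s where "s = real_of_int n + t"
  have "b * s + \<bar>s\<bar> \<le> (\<bar>b\<bar> + 1) * \<bar>s\<bar>"
    by (simp add: distrib_right) (metis abs_ge_self abs_mult)
  also have "(\<bar>b\<bar> + 1) * \<bar>s\<bar> \<le> (\<bar>b\<bar> + 1)\<^sup>2 / (4 * a) + a * s\<^sup>2"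
  proof -
    have "0 \<le> (\<bar>b\<bar> + 1 - 2 * a * \<bar>s\<bar>)\<^sup>2 / (4 * a)" using a by simp
    also have "\<dots> = (\<bar>b\<bar> + 1)\<^sup>2 / (4 * a) - (\<bar>b\<bar> + 1) * \<bar>s\<bar> + a * \<bar>s\<bar>\<^sup>2"
      using a by (simp add: field_simps power2_eq_square)
    finally show ?thesis by simp
  qed
  finally have "b * s - a * s\<^sup>2 \<le> K - \<bar>real_of_int n\<bar>"
    unfolding K_def s_def by linarith
  then show "exp (b * (real_of_int n + t) - a * (real_of_int n + t)\<^sup>2)
      \<le> exp K * exp (- \<bar>real_of_int n\<bar>)"
    by (simp add: s_def exp_add[symmetric])
qed auto

text \<open>A finite partial sum is enlarged to the box of its coordinate projections, where it
  factors; each factor is at most the full sum in that coordinate.\<close>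

lemma summable_on_prod_PiE_nonneg:
  fixes f :: "'a \<Rightarrow> 'b \<Rightarrow> real"
  assumes A: "finite A" and f: "\<And>x. x \<in> A \<Longrightarrow> f x summable_on B x"
    and nonneg: "\<And>x y. x \<in> A \<Longrightarrow> y \<in> B x \<Longrightarrow> f x y \<ge> 0"
  shows "(\<lambda>g. \<Prod>x\<in>A. f x (g x)) summable_on PiE A B"
proof (rule nonneg_bdd_above_summable_on)
  show "0 \<le> (\<Prod>x\<in>A. f x (g x))" if "g \<in> PiE A B" for g
    using that nonneg by (intro prod_nonneg) (auto simp: PiE_iff)
  show "bdd_above (sum (\<lambda>g. \<Prod>x\<in>A. f x (g x)) ` {F. F \<subseteq> PiE A B \<and> finite F})"
  proof (rule bdd_aboveI2)
    fix F assume "F \<in> {F. F \<subseteq> PiE A B \<and> finite F}"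
    then have F: "F \<subseteq> PiE A B" "finite F" by auto
    define C where "C x = (\<lambda>g. g x) ` F" for x
    have C: "C x \<subseteq> B x" if "x \<in> A" for x using F(1) that by (auto simp: C_def PiE_iff)
    have finC: "finite (C x)" for x using F(2) by (simp add: C_def)
    have FC: "F \<subseteq> PiE A C" using F(1) by (auto simp: C_def PiE_iff)
    have "(\<Sum>g\<in>F. \<Prod>x\<in>A. f x (g x)) \<le> (\<Sum>g\<in>PiE A C. \<Prod>x\<in>A. f x (g x))"
      using A finC FC C nonneg
      by (intro sum_mono2 finite_PiE prod_nonneg) (auto simp: PiE_iff, blast)
    also have "\<dots> = (\<Prod>x\<in>A. \<Sum>y\<in>C x. f x y)"
      using A finC by (intro prod_sum_PiE[symmetric]) auto
    also have "\<dots> \<le> (\<Prod>x\<in>A. infsum (f x) (B x))"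
      using C finC f nonneg
      by (intro prod_mono conjI sum_nonneg finite_sum_le_infsum) blast+
    finally show "(\<Sum>g\<in>F. \<Prod>x\<in>A. f x (g x)) \<le> (\<Prod>x\<in>A. infsum (f x) (B x))" .
  qed
qed

lemma coset_int_span_eq_image:
  assumes "(\<Sum>b\<in>E. t b *\<^sub>R b) = x0"
  shows "x0 +o int_span E = (\<lambda>n. \<Sum>b\<in>E. (of_int (n b) + t b) *\<^sub>R b) ` (E \<rightarrow>\<^sub>E UNIV)"
proof (intro equalityI subsetI)
  fix x assume "x \<in> x0 +o int_span E"
  then obtain c :: "'a \<Rightarrow> int" where "x = x0 + (\<Sum>b\<in>E. of_int (c b) *\<^sub>R b)"
    by (auto simp: elt_set_plus_def int_span_def)
  then have "x = (\<Sum>b\<in>E. (of_int (restrict c E b) + t b) *\<^sub>R b)"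
    by (simp add: assms[symmetric] scaleR_add_left sum.distrib)
  then show "x \<in> (\<lambda>n. \<Sum>b\<in>E. (of_int (n b) + t b) *\<^sub>R b) ` (E \<rightarrow>\<^sub>E UNIV)"
    by (intro image_eqI[where x = "restrict c E"]) auto
next
  fix x assume "x \<in> (\<lambda>n. \<Sum>b\<in>E. (of_int (n b) + t b) *\<^sub>R b) ` (E \<rightarrow>\<^sub>E UNIV)"
  then obtain n where "x = (\<Sum>b\<in>E. (of_int (n b) + t b) *\<^sub>R b)" by auto
  then have "x = x0 + (\<Sum>b\<in>E. of_int (n b) *\<^sub>R b)"
    by (simp add: assms[symmetric] scaleR_add_left sum.distrib)
  then show "x \<in> x0 +o int_span E" by (auto simp: elt_set_plus_def int_span_def)
qed

text \<open>In coordinates the form dominates a multiple of the sum of squares, so the summand is at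
  most a product of one-dimensional Gaussians, shifted by the coordinates \<open>t\<close> of
  \<open>x0\<close>.\<close>

lemma summable_on_gaussian_coset:
  fixes R :: "'v::real_vector \<Rightarrow> 'v \<Rightarrow> real" and l :: "'v \<Rightarrow> real"
  assumes R: "bilinear R" and sym: "\<And>x y. R x y = R y x"
    and pos: "\<And>x. x \<noteq> 0 \<Longrightarrow> R x x > 0" and l: "linear l"
    and E: "finite E" "independent E" "span E = UNIV"
  shows "(\<lambda>x. exp (l x - R x x)) summable_on (x0 +o int_span E)"
proof -
  obtain c where c: "c > 0"
    "\<And>a. c * (\<Sum>e\<in>E. (a e)\<^sup>2) \<le> R (\<Sum>e\<in>E. a e *\<^sub>R e) (\<Sum>e\<in>E. a e *\<^sub>R e)"
    using posdef_ge_sum_squares[OF R sym pos E(1,2)] by blast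
  obtain t where t: "(\<Sum>b\<in>E. t b *\<^sub>R b) = x0"
  proof -
    have "x0 \<in> range (\<lambda>u. \<Sum>b\<in>E. u b *\<^sub>R b)" using E(3) span_finite[OF E(1)] by simp
    then show thesis using that by auto
  qed
  define h :: "('v \<Rightarrow> int) \<Rightarrow> 'v" where "h n = (\<Sum>b\<in>E. (of_int (n b) + t b) *\<^sub>R b)" for n
  \<comment> \<open>Linear independence makes the parametrization of the coset injective, so
    summability can be transferred along it.\<close>
  have inj: "inj_on h (E \<rightarrow>\<^sub>E UNIV)"
  proof (rule inj_onI)
    fix n m assume nm: "n \<in> E \<rightarrow>\<^sub>E UNIV" "m \<in> E \<rightarrow>\<^sub>E UNIV" "h n = h m"
    have "(\<Sum>b\<in>E. (of_int (n b) - of_int (m b)) *\<^sub>R b) = h n - h m"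
      by (simp add: h_def sum_subtractf[symmetric] algebra_simps)
    then have "(\<Sum>b\<in>E. (of_int (n b) - of_int (m b)) *\<^sub>R b) = 0" using nm(3) by simp
    then have "of_int (n b) - of_int (m b) = (0::real)" if "b \<in> E" for b
      by (rule independentD[OF E(2,1) order_refl _ that,
            where u = "\<lambda>b. of_int (n b) - of_int (m b)"])
    then show "n = m" using nm(1,2) by (intro PiE_ext) auto
  qed
  have "(\<lambda>n. \<Prod>b\<in>E. exp (l b * (real_of_int (n b) + t b) - c * (real_of_int (n b) + t b)\<^sup>2))
      summable_on (E \<rightarrow>\<^sub>E UNIV)"
    using E(1) c(1) by (intro summable_on_prod_PiE_nonneg summable_on_gaussian_int) auto
  then have "(\<lambda>n. exp (l (h n) - R (h n) (h n))) summable_on (E \<rightarrow>\<^sub>E UNIV)"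
  proof (rule summable_on_comparison_test)
    fix n :: "'v \<Rightarrow> int"
    have "l (h n) = (\<Sum>b\<in>E. l b * (real_of_int (n b) + t b))"
      by (simp add: h_def linear_sum[OF l] linear_cmul[OF l] mult.commute)
    then have "l (h n) - R (h n) (h n)
        \<le> (\<Sum>b\<in>E. l b * (real_of_int (n b) + t b) - c * (real_of_int (n b) + t b)\<^sup>2)"
      using c(2)[of "\<lambda>b. real_of_int (n b) + t b"]
      by (simp add: h_def sum_subtractf sum_distrib_left)
    then show "exp (l (h n) - R (h n) (h n))
        \<le> (\<Prod>b\<in>E. exp (l b * (real_of_int (n b) + t b) - c * (real_of_int (n b) + t b)\<^sup>2))"
      using E(1) by (simp add: exp_sum[symmetric])
  qed auto
  then have "(\<lambda>x. exp (l x - R x x)) summable_on (h ` (E \<rightarrow>\<^sub>E UNIV))"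
    by (subst summable_on_reindex[OF inj]) (simp add: o_def)
  then show ?thesis unfolding coset_int_span_eq_image[OF t] h_def .
qed


section \<open>The majorant of a point of the Grassmannian\<close>

text \<open>Two candidates differ by a vector of \<open>W\<close> that is orthogonal to itself.
  Asking only that \<open>B w w\<close> not vanish covers both the positive and the negative part of
  a point of the Grassmannian.\<close>

lemma orth_proj_eq:
  assumes B: "bilinear B" and W: "subspace W" and def: "\<And>w. w \<in> W \<Longrightarrow> w \<noteq> 0 \<Longrightarrow> B w w \<noteq> 0"
    and p: "p \<in> W" and u: "\<And>w. w \<in> W \<Longrightarrow> B u w = 0"
  shows "orth_proj B W (p + u) = p"
  unfolding orth_proj_def
proof (rule the_equality)
  show "p \<in> W \<and> (\<forall>w\<in>W. B (p + u - p) w = 0)" using p u by simp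
  fix q assume q: "q \<in> W \<and> (\<forall>w\<in>W. B (p + u - q) w = 0)"
  have pq: "p - q \<in> W" using p q W by (simp add: subspace_diff)
  have "B (p + u - q) (p - q) = B (p - q) (p - q) + B u (p - q)"
    by (simp add: bilinear_ladd[OF B, symmetric] algebra_simps)
  then have "B (p - q) (p - q) = 0" using q pq u by simp
  with def pq show "q = p" by (metis eq_iff_diff_eq_0)
qed

text \<open>The Siegel majorant: reversing the sign of the form on the negative part makes it
  positive definite.\<close>

definition majorant :: "('v::real_vector \<Rightarrow> 'v \<Rightarrow> real) \<Rightarrow> 'v set \<times> 'v set \<Rightarrow> 'v \<Rightarrow> 'v \<Rightarrow> real" where
  "majorant B v x y = B (orth_proj B (fst v) x) (orth_proj B (fst v) y) -
     B (orth_proj B (snd v) x) (orth_proj B (snd v) y)"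

context
  fixes B :: "'v::real_vector \<Rightarrow> 'v \<Rightarrow> real" and v :: "'v set \<times> 'v set"
  assumes B: "bilinear B" and sym: "\<And>x y. B x y = B y x" and v: "v \<in> Gr B"
begin

lemma orth_proj_Gr:
  assumes "p \<in> fst v" "n \<in> snd v"
  shows "orth_proj B (fst v) (p + n) = p" "orth_proj B (snd v) (p + n) = n"
proof -
  show "orth_proj B (fst v) (p + n) = p"
    using v assms sym by (intro orth_proj_eq[OF B]) (force simp: Gr_def pos_def_on_def)+
  have "orth_proj B (snd v) (n + p) = n"
    using v assms by (intro orth_proj_eq[OF B]) (force simp: Gr_def pos_def_on_def neg_form_def)+
  then show "orth_proj B (snd v) (p + n) = n" by (simp add: add.commute)
qed

lemma Gr_decompose:
  obtains p n where "x = p + n" "p \<in> fst v" "n \<in> snd v"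
proof -
  have "fst v + snd v = UNIV" using v by (auto simp: Gr_def)
  then have "x \<in> fst v + snd v" by simp
  then show thesis using that by (auto elim: set_plus_elim)
qed

lemma linear_orth_proj_Gr: "linear (orth_proj B (fst v))" "linear (orth_proj B (snd v))"
proof -
  have sub: "subspace (fst v)" "subspace (snd v)" using v by (auto simp: Gr_def)
  have add: "orth_proj B (fst v) (x + y) = orth_proj B (fst v) x + orth_proj B (fst v) y \<and>
      orth_proj B (snd v) (x + y) = orth_proj B (snd v) x + orth_proj B (snd v) y" for x y
  proof -
    obtain p n where x: "x = p + n" "p \<in> fst v" "n \<in> snd v" by (rule Gr_decompose)
    obtain q m where y: "y = q + m" "q \<in> fst v" "m \<in> snd v" by (rule Gr_decompose)
    have eq: "x + y = (p + q) + (n + m)" by (simp add: x y)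
    have "p + q \<in> fst v" "n + m \<in> snd v" using sub x y by (auto intro: subspace_add)
    from orth_proj_Gr[OF this, folded eq] show ?thesis
      using orth_proj_Gr[OF x(2,3)] orth_proj_Gr[OF y(2,3)] x(1) y(1) by simp
  qed
  have scale: "orth_proj B (fst v) (c *\<^sub>R x) = c *\<^sub>R orth_proj B (fst v) x \<and>
      orth_proj B (snd v) (c *\<^sub>R x) = c *\<^sub>R orth_proj B (snd v) x" for c x
  proof -
    obtain p n where x: "x = p + n" "p \<in> fst v" "n \<in> snd v" by (rule Gr_decompose)
    have eq: "c *\<^sub>R x = c *\<^sub>R p + c *\<^sub>R n" by (simp add: x scaleR_add_right)
    have "c *\<^sub>R p \<in> fst v" "c *\<^sub>R n \<in> snd v" using sub x by (auto intro: subspace_scale)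
    from orth_proj_Gr[OF this, folded eq] show ?thesis
      using orth_proj_Gr[OF x(2,3)] x(1) by simp
  qed
  show "linear (orth_proj B (fst v))" "linear (orth_proj B (snd v))"
    using add scale by (auto intro!: linearI)
qed

lemma bilinear_majorant: "bilinear (majorant B v)"
  unfolding bilinear_def majorant_def
  by (intro conjI allI linearI)
    (simp_all add: linear_add[OF linear_orth_proj_Gr(1)] linear_add[OF linear_orth_proj_Gr(2)]
      linear_scale[OF linear_orth_proj_Gr(1)] linear_scale[OF linear_orth_proj_Gr(2)]
      bilinear_ladd[OF B] bilinear_radd[OF B] bilinear_lmul[OF B] bilinear_rmul[OF B] algebra_simps)

lemma majorant_sym: "majorant B v x y = majorant B v y x"
  using sym by (simp add: majorant_def)

lemma majorant_pos:
  assumes "x \<noteq> 0"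
  shows "majorant B v x x > 0"
proof -
  obtain p n where x: "x = p + n" "p \<in> fst v" "n \<in> snd v" by (rule Gr_decompose)
  have "majorant B v x x = B p p - B n n"
    using orth_proj_Gr[OF x(2,3)] x(1) by (simp add: majorant_def)
  moreover have "p \<noteq> 0 \<Longrightarrow> B p p > 0" "n \<noteq> 0 \<Longrightarrow> B n n < 0"
    using v x by (auto simp: Gr_def pos_def_on_def neg_form_def)
  moreover have "B 0 0 = 0" by (rule bilinear_lzero[OF B])
  moreover have "p \<noteq> 0 \<or> n \<noteq> 0" using x assms by auto
  ultimately show ?thesis by (cases "p = 0"; cases "n = 0") auto
qed

text \<open>Non-degeneracy against all real vectors, where \<open>even_lattice\<close> speaks only
  of vectors of \<open>L\<close>: \<open>x = p + n\<close> pairs with its reflection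
  \<open>p - n\<close> to the majorant of \<open>x\<close>.\<close>

lemma Gr_nondegenerate:
  assumes "\<And>y. B x y = 0"
  shows "x = 0"
proof (rule ccontr)
  assume "x \<noteq> 0"
  obtain p n where x: "x = p + n" "p \<in> fst v" "n \<in> snd v" by (rule Gr_decompose)
  have "B p n = 0" using v x by (auto simp: Gr_def)
  then have "B x (p - n) = B p p - B n n"
    unfolding x(1) using sym[of p n] by (simp add: bilinear_ladd[OF B] bilinear_rsub[OF B])
  also have "\<dots> = majorant B v x x"
    using orth_proj_Gr[OF x(2,3)] x(1) by (simp add: majorant_def)
  finally show False using majorant_pos[OF \<open>x \<noteq> 0\<close>] assms by simp
qed

end


section \<open>Lattices and discriminant groups\<close>

lemma int_span_zero: "0 \<in> int_span E"
  unfolding int_span_def by (intro CollectI exI[of _ "\<lambda>_. 0"]) simp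

lemma int_span_diff:
  assumes "x \<in> int_span E" "y \<in> int_span E"
  shows "x - y \<in> int_span E"
proof -
  obtain c d where "x = (\<Sum>b\<in>E. of_int (c b) *\<^sub>R b)" "y = (\<Sum>b\<in>E. of_int (d b) *\<^sub>R b)"
    using assms unfolding int_span_def by blast
  then have "x - y = (\<Sum>b\<in>E. of_int (c b - d b) *\<^sub>R b)"
    by (simp add: sum_subtractf scaleR_diff_left)
  then show ?thesis unfolding int_span_def by (intro CollectI exI[of _ "\<lambda>b. c b - d b"]) simp
qed

lemma int_span_base:
  assumes "finite E" "e \<in> E"
  shows "e \<in> int_span E"
  unfolding int_span_def
proof (intro CollectI exI conjI)
  have "(\<Sum>b\<in>E. of_int (if b = e then 1 else 0) *\<^sub>R b) = (\<Sum>b\<in>E. if b = e then b else 0)"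
    by (intro sum.cong) auto
  then show "e = (\<Sum>b\<in>E. of_int (if b = e then 1 else 0) *\<^sub>R b)"
    using assms by simp
qed simp

lemma coset_eq_iff:
  fixes M :: "'v::real_vector set"
  assumes "0 \<in> M" "\<And>x y. x \<in> M \<Longrightarrow> y \<in> M \<Longrightarrow> x - y \<in> M"
  shows "x +o M = y +o M \<longleftrightarrow> x - y \<in> M"
proof
  assume "x +o M = y +o M"
  then have "x \<in> y +o M" using coset_self[OF assms(1)] by blast
  then show "x - y \<in> M" by (auto simp: elt_set_plus_def)
next
  assume xy: "x - y \<in> M"
  have add: "a + b \<in> M" if "a \<in> M" "b \<in> M" for a b
    using assms(2)[OF that(1) assms(2)[OF assms(1) that(2)]] by simp
  have "x + a \<in> y +o M" if "a \<in> M" for a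
    using add[OF xy that] by (auto simp: elt_set_plus_def intro!: bexI[of _ "x - y + a"])
  moreover have "y + a \<in> x +o M" if "a \<in> M" for a
    using assms(2)[OF that xy] by (auto simp: elt_set_plus_def intro!: bexI[of _ "a - (x - y)"])
  ultimately show "x +o M = y +o M" by (force simp: elt_set_plus_def)
qed

lemma diff_closed_of_int_scaleR:
  fixes M :: "'v::real_vector set"
  assumes "0 \<in> M" "\<And>x y. x \<in> M \<Longrightarrow> y \<in> M \<Longrightarrow> x - y \<in> M" "x \<in> M"
  shows "real_of_int k *\<^sub>R x \<in> M"
proof (induction k rule: int_induct[where k = 0])
  case base
  show ?case using assms(1) by simp
next
  case (step1 i)
  have "0 - x \<in> M" using assms by blast
  from assms(2)[OF step1(2) this] show ?case by (simp add: algebra_simps)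
next
  case (step2 i)
  from assms(2)[OF step2(2) assms(3)] show ?case by (simp add: algebra_simps)
qed

lemma diff_closed_sum:
  fixes M :: "'v::real_vector set"
  assumes "0 \<in> M" "\<And>x y. x \<in> M \<Longrightarrow> y \<in> M \<Longrightarrow> x - y \<in> M" "\<And>i. i \<in> I \<Longrightarrow> f i \<in> M"
  shows "sum f I \<in> M"
  using assms(3)
proof (induction I rule: infinite_finite_induct)
  case (insert i I)
  \<comment> \<open>Closure is known for differences only, so adding \<open>f i\<close> is expressed
    as subtracting \<open>0 - f i\<close>.\<close>
  have "0 - f i \<in> M" using assms(1,2) insert.prems by blast
  with insert.IH insert.prems have "sum f I - (0 - f i) \<in> M" by (intro assms(2)[of "sum f I" "0 - f i"]) auto
  then show ?case using insert by (simp add: add.commute)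
qed (use assms(1) in auto)

text \<open>Every class has a representative with coordinates in \<open>[0, 1]\<close>; its pairings with the
  spanning set are integers in a bounded range, and they determine it.\<close>

lemma finite_disc_group:
  fixes B :: "'v::real_vector \<Rightarrow> 'v \<Rightarrow> real"
  assumes B: "bilinear B" and nondeg: "\<And>x. (\<And>y. B x y = 0) \<Longrightarrow> x = 0"
    and M: "0 \<in> M" "\<And>x y. x \<in> M \<Longrightarrow> y \<in> M \<Longrightarrow> x - y \<in> M" "M \<subseteq> dual_lattice B M"
    and E: "finite E" "E \<subseteq> M" "span E = UNIV"
  shows "finite (disc_group B M)"
proof -
  define S where "S = {y \<in> dual_lattice B M. \<exists>a. (\<forall>e\<in>E. 0 \<le> a e \<and> a e \<le> 1) \<and> y = (\<Sum>e\<in>E. a e *\<^sub>R e)}"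
  define K where "K f = (\<Sum>e\<in>E. \<bar>B e f\<bar>)" for f
  have lin: "linear (\<lambda>x. B x y)" "linear (B y)" for y using B by (auto simp: bilinear_def)
  have "finite S"
  proof (rule inj_on_finite)
    show "inj_on (\<lambda>y. restrict (B y) E) S"
    proof (rule inj_onI)
      fix x y assume "restrict (B x) E = restrict (B y) E"
      then have "B x e = B y e" if "e \<in> E" for e
        using that by (metis restrict_apply')
      then have "B (x - y) e = 0" if "e \<in> E" for e using that by (simp add: bilinear_lsub[OF B])
      then have "B (x - y) z = 0" for z
        using linear_eq_0_on_span[OF lin(2), of E "x - y" z] E(3) by simp
      then show "x = y" using nondeg[of "x - y"] by simp
    qed
    show "(\<lambda>y. restrict (B y) E) ` S \<subseteq> (\<Pi>\<^sub>E f\<in>E. {k. k \<in> \<int> \<and> \<bar>k\<bar> \<le> K f})"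
    proof (intro image_subsetI restrict_PiE_iff[THEN iffD2] ballI CollectI conjI)
      fix y f assume y: "y \<in> S" and f: "f \<in> E"
      then show "B y f \<in> \<int>" using E(2) by (auto simp: S_def dual_lattice_def)
      from y obtain a where a: "\<And>e. e \<in> E \<Longrightarrow> 0 \<le> a e \<and> a e \<le> 1" "y = (\<Sum>e\<in>E. a e *\<^sub>R e)"
        by (auto simp: S_def)
      have "\<bar>B y f\<bar> \<le> (\<Sum>e\<in>E. \<bar>a e * B e f\<bar>)"
        unfolding a(2) by (simp add: linear_sum[OF lin(1)] linear_scale[OF lin(1)])
      also have "\<dots> \<le> K f"
        unfolding K_def using a(1) by (intro sum_mono) (simp add: abs_mult mult_left_le_one_le)
      finally show "\<bar>B y f\<bar> \<le> K f" .
    qed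
    show "finite (\<Pi>\<^sub>E f\<in>E. {k. k \<in> \<int> \<and> \<bar>k\<bar> \<le> K f})"
      using E(1) by (intro finite_PiE finite_abs_int_segment)
  qed
  moreover have "disc_group B M \<subseteq> (\<lambda>x. x +o M) ` S"
  proof
    fix \<delta> assume "\<delta> \<in> disc_group B M"
    then obtain x where x: "x \<in> dual_lattice B M" "\<delta> = x +o M"
      by (auto simp: disc_group_def quot_def)
    have "x \<in> range (\<lambda>u. \<Sum>b\<in>E. u b *\<^sub>R b)" using E(3) span_finite[OF E(1)] by simp
    then obtain u where u: "x = (\<Sum>b\<in>E. u b *\<^sub>R b)" by auto
    \<comment> \<open>Subtracting the integer parts of the coordinates moves \<open>x\<close> into
      the unit box; \<open>m\<close> lies in \<open>M\<close>, so the class is unchanged.\<close>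
    define m where "m = (\<Sum>b\<in>E. real_of_int \<lfloor>u b\<rfloor> *\<^sub>R b)"
    have m: "m \<in> M"
      unfolding m_def using E(2) by (intro diff_closed_sum diff_closed_of_int_scaleR M) auto
    have "x - m = (\<Sum>b\<in>E. (u b - real_of_int \<lfloor>u b\<rfloor>) *\<^sub>R b)"
      by (simp add: u m_def sum_subtractf scaleR_diff_left)
    moreover have "\<forall>e\<in>E. 0 \<le> u e - real_of_int \<lfloor>u e\<rfloor> \<and> u e - real_of_int \<lfloor>u e\<rfloor> \<le> 1"
      by (auto intro: less_imp_le simp: algebra_simps) linarith
    moreover have "x - m \<in> dual_lattice B M"
      using x(1) M(3) m by (auto simp: dual_lattice_def bilinear_lsub[OF B])
    ultimately have "x - m \<in> S"
      unfolding S_def by (intro CollectI conjI exI[of _ "\<lambda>e. u e - real_of_int \<lfloor>u e\<rfloor>"])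
    moreover have "\<delta> = (x - m) +o M"
      unfolding x(2) using m by (subst coset_eq_iff[OF M(1,2)]) auto
    ultimately show "\<delta> \<in> (\<lambda>x. x +o M) ` S" by blast
  qed
  ultimately show ?thesis by (meson finite_imageI finite_subset)
qed

text \<open>Pigeonhole: two of the infinitely many integer multiples of \<open>x\<close> share a
  coset of \<open>M\<close>, and their difference is the required multiple.\<close>

lemma finite_index_multiple:
  fixes M L :: "'v::real_vector set"
  assumes M: "finite_index_sublattice M L"
    and L: "0 \<in> L" "\<And>x y. x \<in> L \<Longrightarrow> y \<in> L \<Longrightarrow> x - y \<in> L" and x: "x \<in> L"
  shows "\<exists>n::int. n \<noteq> 0 \<and> real_of_int n *\<^sub>R x \<in> M"
proof -
  have "(\<lambda>n::int. (real_of_int n *\<^sub>R x) +o M) ` UNIV \<subseteq> (\<lambda>x. x +o M) ` L"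
    using diff_closed_of_int_scaleR[OF L x] by blast
  then have "finite (range (\<lambda>n::int. (real_of_int n *\<^sub>R x) +o M))"
    using M unfolding finite_index_sublattice_def by (blast intro: finite_subset)
  then have "\<not> inj (\<lambda>n::int. (real_of_int n *\<^sub>R x) +o M)"
    using finite_imageD infinite_UNIV_int by blast
  then obtain n m :: int where nm: "n \<noteq> m" "(real_of_int n *\<^sub>R x) +o M = (real_of_int m *\<^sub>R x) +o M"
    by (auto simp: inj_def)
  then have "real_of_int n *\<^sub>R x - real_of_int m *\<^sub>R x \<in> M"
    using M by (subst (asm) coset_eq_iff) (auto simp: finite_index_sublattice_def)
  then show ?thesis
    using nm(1) by (intro exI[of _ "n - m"]) (simp add: scaleR_diff_left)
qed

lemma even_latticeD:
  assumes "even_lattice B L"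
  shows "bilinear B" "B x y = B y x" "0 \<in> L" "a \<in> L \<Longrightarrow> b \<in> L \<Longrightarrow> a - b \<in> L"
    "a \<in> L \<Longrightarrow> b \<in> L \<Longrightarrow> a + b \<in> L" "L \<subseteq> dual_lattice B L"
proof -
  from assms obtain E where L: "L = int_span E" by (auto simp: even_lattice_def)
  show "bilinear B" "B x y = B y x" "L \<subseteq> dual_lattice B L"
    using assms by (auto simp: even_lattice_def dual_lattice_def)
  show "0 \<in> L" unfolding L by (rule int_span_zero)
  show diff: "a - b \<in> L" if "a \<in> L" "b \<in> L" for a b
    using that unfolding L by (rule int_span_diff)
  show "a + b \<in> L" if "a \<in> L" "b \<in> L"
    using diff[OF that(1) diff[OF \<open>0 \<in> L\<close> that(2)]] by simp
qed

text \<open>No basis of \<open>M\<close> is at hand. Non-zero multiples of the basis vectors of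
  \<open>L\<close> lie in \<open>M\<close> and span the real space, which suffices for the
  finiteness argument; integrality is inherited from \<open>L\<close>.\<close>

lemma finite_disc_group_sublattice:
  fixes B :: "'v::real_vector \<Rightarrow> 'v \<Rightarrow> real"
  assumes L: "even_lattice B L" and M: "finite_index_sublattice M L" and v: "v \<in> Gr B"
  shows "finite (disc_group B M)"
proof -
  note LD = even_latticeD[OF L]
  have MD: "M \<subseteq> L" "0 \<in> M" "\<And>x y. x \<in> M \<Longrightarrow> y \<in> M \<Longrightarrow> x - y \<in> M"
    using M by (auto simp: finite_index_sublattice_def)
  obtain E where E: "finite E" "span E = UNIV" "L = int_span E"
    using L by (auto simp: even_lattice_def)
  have "\<exists>n::int. n \<noteq> 0 \<and> real_of_int n *\<^sub>R e \<in> M" if "e \<in> E" for e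
    using that E(1,3) int_span_base by (intro finite_index_multiple[OF M LD(3,4)]) auto
  then obtain n :: "'v \<Rightarrow> int" where n: "\<And>e. e \<in> E \<Longrightarrow> n e \<noteq> 0 \<and> real_of_int (n e) *\<^sub>R e \<in> M"
    by metis
  define E' where "E' = (\<lambda>e. real_of_int (n e) *\<^sub>R e) ` E"
  have "e \<in> span E'" if "e \<in> E" for e
  proof -
    have "inverse (real_of_int (n e)) *\<^sub>R (real_of_int (n e) *\<^sub>R e) \<in> span E'"
      using that unfolding E'_def by (intro span_scale span_base imageI)
    then show ?thesis using n[OF that] by simp
  qed
  then have "span E \<subseteq> span E'" by (intro span_minimal) auto
  then have "span E' = UNIV" using E(2) by auto
  moreover have "M \<subseteq> dual_lattice B M" using LD(6) MD(1) by (auto simp: dual_lattice_def)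
  ultimately show ?thesis
    using E(1) n Gr_nondegenerate[OF LD(1,2) v]
    by (intro finite_disc_group[OF LD(1) _ MD(2,3), of E']) (auto simp: E'_def)
qed

text \<open>Makes the finiteness result for sublattices available for \<open>L\<close>
  itself.\<close>

lemma finite_index_sublattice_refl:
  assumes "even_lattice B L"
  shows "finite_index_sublattice L L"
proof -
  note LD = even_latticeD[OF assms]
  have "x +o L = 0 +o L" if "x \<in> L" for x
    using that by (subst coset_eq_iff) (auto intro: LD)
  then have "(\<lambda>x. x +o L) ` L \<subseteq> {0 +o L}" by auto
  then show ?thesis unfolding finite_index_sublattice_def using LD(3,4) finite_subset by blast
qed


section \<open>Theta sums over cosets\<close>

text \<open>The summand of \<open>Theta\<close> as a function on the whole space. It does not depend
  on the lattice, so one function is summed over the cosets of both lattices.\<close>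

definition theta_term ::
  "('v::real_vector \<Rightarrow> 'v \<Rightarrow> real) \<Rightarrow> 'v set \<times> 'v set \<Rightarrow> complex \<Rightarrow> 'v \<times> 'v \<Rightarrow> 'v \<Rightarrow> complex" where
  "theta_term B v \<tau> \<zeta> x = (let xp = orth_proj B (fst v) x; xm = orth_proj B (snd v) x in
     ee (\<tau> * of_real (B xp xp / 2) + cnj \<tau> * of_real (B xm xm / 2) + pair_complex B x \<zeta>))"

text \<open>The conjugate of \<tau> on the negative part reverses the sign there, which produces the
  majorant; the imaginary part of \<zeta> contributes the linear term.\<close>

lemma norm_theta_term:
  "norm (theta_term B v \<tau> \<zeta> x) = exp (- 2 * pi * B x (snd \<zeta>) - pi * Im \<tau> * majorant B v x x)"
  by (simp add: theta_term_def ee_def Let_def norm_exp_eq_Re pair_complex_def majorant_def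
      algebra_simps)

text \<open>Convergence is absolute: the modulus is the Gaussian of a positive multiple of the
  majorant, times the exponential of a linear function.\<close>

lemma summable_on_theta_term:
  fixes B :: "'v::real_vector \<Rightarrow> 'v \<Rightarrow> real"
  assumes L: "even_lattice B L" and v: "v \<in> Gr B" and \<tau>: "\<tau> \<in> upper_half"
  shows "theta_term B v \<tau> \<zeta> summable_on (x +o L)"
proof -
  note LD = even_latticeD[OF L]
  obtain E where E: "finite E" "independent E" "span E = UNIV" "L = int_span E"
    using L by (auto simp: even_lattice_def)
  have pos: "pi * Im \<tau> > 0" using \<tau> by (simp add: upper_half_def)
  note R = bilinear_majorant[OF LD(1,2) v]
  have bil: "bilinear (\<lambda>x y. pi * Im \<tau> * majorant B v x y)"
    unfolding bilinear_def
    by (intro conjI allI linearI)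
      (simp_all add: bilinear_ladd[OF R] bilinear_radd[OF R] bilinear_lmul[OF R]
        bilinear_rmul[OF R] algebra_simps)
  have "linear (\<lambda>x. - 2 * pi * B x (snd \<zeta>))"
    by (intro linearI) (simp_all add: bilinear_ladd[OF LD(1)] bilinear_lmul[OF LD(1)] algebra_simps)
  with bil have "(\<lambda>x. exp (- 2 * pi * B x (snd \<zeta>) - pi * Im \<tau> * majorant B v x x)) summable_on (x +o L)"
    unfolding E(4) using E(1-3) pos majorant_sym[OF LD(1,2) v] majorant_pos[OF LD(1,2) v]
    by (intro summable_on_gaussian_coset) (auto simp: mult_pos_pos)
  then have "(\<lambda>x. norm (theta_term B v \<tau> \<zeta> x)) summable_on (x +o L)" by (simp add: norm_theta_term)
  then show ?thesis by (rule abs_summable_summable)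
qed

text \<open>\<open>\<gamma>\<close> need not be a group: being stable under translation by
  \<open>M\<close>, it is the disjoint union of the pieces in \<open>quot \<gamma> M\<close>, and
  finite additivity applies.\<close>

lemma infsum_coset_partition:
  fixes f :: "'v::real_vector \<Rightarrow> 'b::banach"
  assumes M: "0 \<in> M" "\<And>x y. x \<in> M \<Longrightarrow> y \<in> M \<Longrightarrow> x - y \<in> M"
    and \<gamma>: "\<And>x m. x \<in> \<gamma> \<Longrightarrow> m \<in> M \<Longrightarrow> x + m \<in> \<gamma>"
    and fin: "finite (quot \<gamma> M)" and f: "f summable_on \<gamma>"
  shows "(\<Sum>\<delta>\<in>quot \<gamma> M. infsum f \<delta>) = infsum f \<gamma>"
proof -
  have sub: "\<delta> \<subseteq> \<gamma>" if "\<delta> \<in> quot \<gamma> M" for \<delta>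
    using that \<gamma> by (auto simp: quot_def elt_set_plus_def)
  have "\<delta> \<inter> \<delta>' = {}" if \<delta>s: "\<delta> \<in> quot \<gamma> M" "\<delta>' \<in> quot \<gamma> M" "\<delta> \<noteq> \<delta>'" for \<delta> \<delta>'
  proof -
    obtain x y where xy: "\<delta> = x +o M" "\<delta>' = y +o M" using \<delta>s(1,2) unfolding quot_def by blast
    have "\<delta> = \<delta>'" if "z \<in> \<delta>" "z \<in> \<delta>'" for z
    proof -
      have "z - x \<in> M" using that(1) by (auto simp: xy elt_set_plus_def)
      moreover have "z - y \<in> M" using that(2) by (auto simp: xy elt_set_plus_def)
      ultimately have "z +o M = \<delta>" "z +o M = \<delta>'" by (simp_all add: xy coset_eq_iff[OF M])
      then show ?thesis by simp
    qed
    then show ?thesis using \<delta>s(3) by blast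
  qed
  \<comment> \<open>Summability on each piece follows from summability on \<open>\<gamma>\<close> by
    completeness.\<close>
  then have "(\<Sum>\<delta>\<in>quot \<gamma> M. infsum f \<delta>) = infsum f (\<Union>\<delta>\<in>quot \<gamma> M. \<delta>)"
    using fin sub summable_on_subset_banach[OF f] by (intro sum_infsum) auto
  also have "(\<Union>\<delta>\<in>quot \<gamma> M. \<delta>) = \<gamma>"
    using sub coset_self[OF M(1)] by (auto simp: quot_def)
  finally show ?thesis .
qed

section \<open>Associated functions and arrow operators in components\<close>

lemma Phi_eq_sum:
  assumes "finite (disc_group B L)"
  shows "Phi B L v F \<tau> \<zeta> = (\<Sum>\<gamma>\<in>disc_group B L. infsum (theta_term B v \<tau> \<zeta>) \<gamma> * F \<tau> \<gamma>)"
  unfolding Phi_def pairing_def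
  \<comment> \<open>Finiteness makes the expansion in basis elements return its components; over an
    infinite index set the sum would be 0.\<close>
  using assms by (intro sum.cong refl)
    (simp add: Theta_def basis_elt_def theta_term_def[abs_def] if_distrib cong: if_cong)

text \<open>A basis element and its dual are encoded by the same function, so \<open>omega\<close>
  merely cuts off values outside the discriminant group.\<close>

lemma omega_eq:
  assumes "finite (disc_group B L)" "\<gamma> \<in> disc_group B L"
  shows "omega B L U \<gamma> = U \<gamma>"
  using assms by (simp add: omega_def basis_elt_def if_distrib cong: if_cong)

text \<open>Describes the fibres of the projection from the orthogonal complement of
  \<open>H\<close> to the discriminant group of \<open>L\<close>: it sends \<open>y +o M\<close> to
  \<open>y +o L\<close>, so over \<open>\<gamma>\<close> lie the cosets of \<open>M\<close> with a
  representative in \<open>\<gamma>\<close>.\<close>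

lemma disc_perp_fibre:
  assumes L: "even_lattice B L" and M: "finite_index_sublattice M L" and \<gamma>: "\<gamma> \<in> disc_group B L"
  shows "{\<delta> \<in> disc_perp B M (quot L M). \<Union>(\<delta> +o quot L M) = \<gamma>} = quot \<gamma> M"
proof -
  note LD = even_latticeD[OF L]
  have MD: "M \<subseteq> L" "0 \<in> M" "\<And>x y. x \<in> M \<Longrightarrow> y \<in> M \<Longrightarrow> x - y \<in> M"
    using M by (auto simp: finite_index_sublattice_def)
  have U: "\<Union>((y +o M) +o quot L M) = y +o L" for y
    by (rule Union_coset_quot[OF MD(2) LD(5) MD(1,3)])
  obtain x where x: "x \<in> dual_lattice B L" "\<gamma> = x +o L"
    using \<gamma> by (auto simp: disc_group_def quot_def)
  \<comment> \<open>The fibre on the level of representatives; \<open>L\<close> lies in its dual, so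
    all of \<open>\<gamma>\<close> does.\<close>
  have "y \<in> dual_lattice B L \<and> y +o L = \<gamma> \<longleftrightarrow> y \<in> \<gamma>" for y
  proof
    assume "y \<in> dual_lattice B L \<and> y +o L = \<gamma>"
    then show "y \<in> \<gamma>" using coset_self[OF LD(3)] by blast
  next
    assume "y \<in> \<gamma>"
    then obtain z where z: "z \<in> L" "y = x + z" by (auto simp: x(2) elt_set_plus_def)
    then have "y \<in> dual_lattice B L"
      using x(1) LD(6) by (auto simp: dual_lattice_def bilinear_ladd[OF LD(1)])
    moreover have "y +o L = \<gamma>" unfolding x(2) using z LD(3,4) by (subst coset_eq_iff) auto
    ultimately show "y \<in> dual_lattice B L \<and> y +o L = \<gamma>" by blast
  qed
  then have fibre: "{y \<in> dual_lattice B L. y +o L = \<gamma>} = \<gamma>" by blast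
  have "{\<delta> \<in> quot A M. \<Union>(\<delta> +o quot L M) = \<gamma>} =
      (\<lambda>y. y +o M) ` {y \<in> A. \<Union>((y +o M) +o quot L M) = \<gamma>}" for A
    unfolding quot_def[of A] by blast
  then show ?thesis
    unfolding disc_perp_quot[OF L M] U fibre quot_def[of \<gamma>] by (simp only: fibre)
qed

text \<open>The inner sum over a fibre is its indicator function. The sum over
  \<open>\<gamma>\<close> is kept, although a coset of \<open>M\<close> lies in at most one
  \<open>\<gamma>\<close>, so that the order of summation can be exchanged later.\<close>

lemma up_arrow_eq:
  assumes L: "even_lattice B L" and M: "finite_index_sublattice M L" and fin: "finite (disc_group B M)"
  shows "up_arrow B L M U \<delta> = (\<Sum>\<gamma>\<in>disc_group B L. if \<delta> \<in> quot \<gamma> M then U \<gamma> else 0)"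
  unfolding up_arrow_def Let_def
proof (intro sum.cong refl)
  fix \<gamma> assume \<gamma>: "\<gamma> \<in> disc_group B L"
  note fibre = disc_perp_fibre[OF L M \<gamma>]
  have "finite (quot \<gamma> M)"
    unfolding fibre[symmetric] by (rule finite_subset[OF _ fin]) (auto simp: disc_perp_def)
  then show "U \<gamma> * (\<Sum>\<delta>' | \<delta>' \<in> disc_perp B M (quot L M) \<and> \<Union>(\<delta>' +o quot L M) = \<gamma>. basis_elt \<delta>' \<delta>)
      = (if \<delta> \<in> quot \<gamma> M then U \<gamma> else 0)"
    by (simp add: fibre basis_elt_def)
qed

text \<open>Integrality of a pairing is insensitive to its sign, so both lattices have the same
  orthogonal complement of \<open>H\<close>.\<close>

lemma up_arrow_neg_form: "up_arrow (neg_form B) L M = up_arrow B L M"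
  proof -
  have "disc_perp (neg_form B) = disc_perp B"
    by (intro ext) (simp add: disc_perp_def disc_group_neg_form, simp add: neg_form_def)
  then show ?thesis by (intro ext) (simp add: up_arrow_def disc_group_neg_form)
qed

section \<open>The two identities for associated functions\<close>

lemma Phi_up_arrow:
  fixes B :: "'v::real_vector \<Rightarrow> 'v \<Rightarrow> real"
  assumes L: "even_lattice B L" and M: "finite_index_sublattice M L" and v: "v \<in> Gr B"
    and \<tau>: "\<tau> \<in> upper_half"
  shows "Phi B M v (\<lambda>\<tau>. up_arrow B L M (F \<tau>)) \<tau> \<zeta> = Phi B L v F \<tau> \<zeta>"
proof -
  note LD = even_latticeD[OF L]
  have MD: "M \<subseteq> L" "0 \<in> M" "\<And>x y. x \<in> M \<Longrightarrow> y \<in> M \<Longrightarrow> x - y \<in> M"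
    using M by (auto simp: finite_index_sublattice_def)
  note finM = finite_disc_group_sublattice[OF L M v]
  note finL = finite_disc_group_sublattice[OF L finite_index_sublattice_refl[OF L] v]
  let ?\<theta> = "infsum (theta_term B v \<tau> \<zeta>)"
  \<comment> \<open>This sum will be the coefficient of \<open>F \<tau> \<gamma>\<close>: the theta
    sums over the cosets of \<open>M\<close> inside \<open>\<gamma>\<close> recombine to the one
    over \<open>\<gamma>\<close>.\<close>
  have fibre: "(\<Sum>\<delta>\<in>disc_group B M. if \<delta> \<in> quot \<gamma> M then ?\<theta> \<delta> else 0) = ?\<theta> \<gamma>"
    if \<gamma>: "\<gamma> \<in> disc_group B L" for \<gamma>
  proof -
    have sub: "quot \<gamma> M \<subseteq> disc_group B M"
      unfolding disc_perp_fibre[OF L M \<gamma>, symmetric] by (auto simp: disc_perp_def)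
    obtain x where x: "\<gamma> = x +o L" using \<gamma> by (auto simp: disc_group_def quot_def)
    have "(\<Sum>\<delta>\<in>disc_group B M. if \<delta> \<in> quot \<gamma> M then ?\<theta> \<delta> else 0) = (\<Sum>\<delta>\<in>quot \<gamma> M. ?\<theta> \<delta>)"
      using finM sub by (simp add: sum.inter_restrict[symmetric] Int_absorb1)
    also have "\<dots> = ?\<theta> \<gamma>"
    proof (rule infsum_coset_partition[OF MD(2,3)])
      show "y + m \<in> \<gamma>" if "y \<in> \<gamma>" "m \<in> M" for y m
        using that MD(1) LD(5) by (auto simp: x elt_set_plus_def add.assoc)
      show "theta_term B v \<tau> \<zeta> summable_on \<gamma>"
        unfolding x by (rule summable_on_theta_term[OF L v \<tau>])
      show "finite (quot \<gamma> M)" by (rule finite_subset[OF sub finM])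
    qed
    finally show ?thesis .
  qed
  \<comment> \<open>The indicator is moved from the component of \<open>F\<close> to the theta sum,
    in preparation for summing over \<open>\<delta>\<close> first.\<close>
  have "Phi B M v (\<lambda>\<tau>. up_arrow B L M (F \<tau>)) \<tau> \<zeta> =
      (\<Sum>\<delta>\<in>disc_group B M. \<Sum>\<gamma>\<in>disc_group B L. (if \<delta> \<in> quot \<gamma> M then ?\<theta> \<delta> else 0) * F \<tau> \<gamma>)"
    unfolding Phi_eq_sum[OF finM] up_arrow_eq[OF L M finM] sum_distrib_left
    by (intro sum.cong refl) simp
  also have "\<dots> = (\<Sum>\<gamma>\<in>disc_group B L. ?\<theta> \<gamma> * F \<tau> \<gamma>)"
    by (subst sum.swap) (simp add: sum_distrib_right[symmetric] fibre)
  finally show ?thesis unfolding Phi_eq_sum[OF finL] .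
qed

text \<open>\<open>omega\<close> commutes with the arrow operator on the components that the pairing
  sees, which reduces the claim to the previous identity for
  \<open>tilde_form B L G\<close>.\<close>

lemma Phi_tilde_up_arrow:
  fixes B :: "'v::real_vector \<Rightarrow> 'v \<Rightarrow> real"
  assumes L: "even_lattice B L" and M: "finite_index_sublattice M L" and v: "v \<in> Gr B"
    and \<tau>: "\<tau> \<in> upper_half"
  shows "Phi_tilde B M v (\<lambda>\<tau>. up_arrow B L M (G \<tau>)) \<tau> \<zeta> = Phi_tilde B L v G \<tau> \<zeta>"
proof -
  note finM = finite_disc_group_sublattice[OF L M v]
  note finL = finite_disc_group_sublattice[OF L finite_index_sublattice_refl[OF L] v]
  \<comment> \<open>The arrow operator reads its argument only on the discriminant group of
    \<open>L\<close>, where \<open>omega\<close> changes nothing.\<close>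
  have "up_arrow B L M (omega B L U) = up_arrow B L M U" for U
    by (intro ext sum.cong refl, unfold up_arrow_eq[OF L M finM])
      (intro sum.cong refl, simp add: omega_eq[OF finL])
  then have "Phi_tilde B M v (\<lambda>\<tau>. up_arrow B L M (G \<tau>)) \<tau> \<zeta> =
      Phi B M v (\<lambda>\<tau>. up_arrow B L M (tilde_form B L G \<tau>)) \<tau> \<zeta>"
    unfolding Phi_tilde_def Phi_eq_sum[OF finM]
    by (intro sum.cong refl) (simp add: tilde_form_def omega_eq[OF finM])
  then show ?thesis by (simp add: Phi_up_arrow[OF L M v \<tau>] Phi_tilde_def)
qed

theorem proposition3p4:
  fixes B :: "'v::real_vector \<Rightarrow> 'v \<Rightarrow> real" and L \<Lambda> :: "'v set"
    and bp bm :: nat and v :: "'v set \<times> 'v set" and \<Gamma> :: "mp2 set" and k l :: real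
    and F G :: "complex \<Rightarrow> 'v set \<Rightarrow> complex"
  assumes "even_lattice B L" and "signature B = (bp, bm)"
    and "finite_index_sublattice \<Lambda> L"
    and "v \<in> Gr B"
    and "subgroup \<Gamma> Mp2Z" and "finite (rcosets\<^bsub>Mp2Z\<^esub> \<Gamma>)"
    and "2 * k \<in> \<int>" and "2 * l \<in> \<int>"
    and "modular_form (disc_group (neg_form B) L) (weil_rep_dual B L)
           (k - real bp / 2, l - real bm / 2) \<Gamma> F"
    and "modular_form (disc_group B L) (weil_rep B L)
           (k - real bm / 2, l - real bp / 2) (mp_tilde ` \<Gamma>) G"
  shows "(\<forall>\<tau>\<in>upper_half. \<forall>\<zeta>.
            Phi B \<Lambda> v (\<lambda>\<tau>. up_arrow (neg_form B) L \<Lambda> (F \<tau>)) \<tau> \<zeta> = Phi B L v F \<tau> \<zeta>) \<and>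
         (\<forall>\<tau>\<in>upper_half. \<forall>\<zeta>.
            Phi_tilde B \<Lambda> v (\<lambda>\<tau>. up_arrow B L \<Lambda> (G \<tau>)) \<tau> \<zeta> = Phi_tilde B L v G \<tau> \<zeta>)"
  \<comment> \<open>The arrow operator for the negated form, which acts on \<open>F\<close>, is
    replaced by the one for \<open>B\<close>.\<close>
  unfolding up_arrow_neg_form
  using Phi_up_arrow[OF assms(1,3,4)] Phi_tilde_up_arrow[OF assms(1,3,4)] by simp

end
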